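(* Let $(C,\sqsubseteq)$ be a complete lattice, let $b^*,b_*\colon C\to C$ be monotone maps with $b^*$ left adjoint to $b_*$ (i.e. $b^*(x)\sqsubseteq y$ iff $x\sqsubseteq b_*(y)$ for all $x,y\in C$), let $a\colon C\to C$ be an up-closure operator, let $i\in C$, and let $f\in C$ with $a(f)\sqsubseteq f$. Suppose that $b^*\circ a\sqsubseteq a\circ b^*$ (equivalently, $a\circ b_*\sqsubseteq b_*\circ a$). Then: (1) $a$ is complete with respect to the map $g=i\sqcup b^*$ (the map $x\mapsto i\sqcup b^*(x)$), i.e. $\alpha(\mu g)=\mu(\alpha\circ g\circ\gamma)$; and (2) $a$ is sound with respect to the map $h=b_*\sqcap f$ (the map $x\mapsto b_*(x)\sqcap f$), i.e. for all $j,x\in C$, if $j\sqsubseteq x\sqsubseteq h(a(x))$ then $j\sqsubseteq \nu h$.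
   Context: All maps are monotone and maps $C\to C$ are ordered pointwise. An up-closure operator is a monotone $a\colon C\to C$ with $x\sqsubseteq a(x)$ and $a(a(x))\sqsubseteq a(x)$ for all $x$. $Pre(a)=\{x\in C\mid a(x)\sqsubseteq x\}$ is a complete lattice with the order of $C$; $\alpha\colon C\to Pre(a)$ is $\alpha(x)=a(x)$ and $\gamma\colon Pre(a)\to C$ is the inclusion. $\mu$ and $\nu$ denote least and greatest fixed points (for $\alpha\circ g\circ\gamma$, the least fixed point in $Pre(a)$). The elements $i,f$ are identified with constant maps when forming $i\sqcup b^*$ and $b_*\sqcap f$. *)

theory Defs
  imports Main
begin

definition up_closure :: "('a::complete_lattice \<Rightarrow> 'a) \<Rightarrow> bool" where
  "up_closure a \<longleftrightarrow> mono a \<and> (\<forall>x. x \<le> a x) \<and> (\<forall>x. a (a x) \<le> a x)"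

definition Pre :: "('a::complete_lattice \<Rightarrow> 'a) \<Rightarrow> 'a set" where
  "Pre a = {x. a x \<le> x}"

text \<open>\<open>Pre a\<close> depends on the term \<open>a\<close> and hence cannot be a type. The maps
  \<open>\<alpha> : C \<rightarrow> Pre a\<close> and \<open>\<gamma> : Pre a \<rightarrow> C\<close> are therefore given on the ambient type;
  only the values of \<open>\<gamma>\<close> on \<open>Pre a\<close> are relevant.\<close>

definition abstr :: "('a::complete_lattice \<Rightarrow> 'a) \<Rightarrow> 'a \<Rightarrow> 'a" where
  "abstr a x = a x"

definition concr :: "'a::complete_lattice \<Rightarrow> 'a" where
  "concr x = x"

text \<open>Least fixed point of a self-map of the subset \<open>P\<close>, with the induced order: the least
  element of the set of those fixed points that lie in \<open>P\<close>. For monotone self-maps of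
  \<open>P = Pre a\<close> it exists, see \<open>lfp_on_Pre\<close> below.\<close>

definition lfp_on :: "'a::complete_lattice set \<Rightarrow> ('a \<Rightarrow> 'a) \<Rightarrow> 'a" where
  "lfp_on P F = (LEAST x. x \<in> P \<and> F x = x)"

definition complete_wrt :: "('a::complete_lattice \<Rightarrow> 'a) \<Rightarrow> ('a \<Rightarrow> 'a) \<Rightarrow> bool" where
  "complete_wrt a g \<longleftrightarrow> abstr a (lfp g) = lfp_on (Pre a) (abstr a \<circ> g \<circ> concr)"

definition sound_wrt :: "('a::complete_lattice \<Rightarrow> 'a) \<Rightarrow> ('a \<Rightarrow> 'a) \<Rightarrow> bool" where
  "sound_wrt a h \<longleftrightarrow> (\<forall>j x. j \<le> x \<and> x \<le> h (a x) \<longrightarrow> j \<le> gfp h)"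

definition left_adjoint :: "('a::complete_lattice \<Rightarrow> 'a) \<Rightarrow> ('a \<Rightarrow> 'a) \<Rightarrow> bool" where
  "left_adjoint l r \<longleftrightarrow> (\<forall>x y. l x \<le> y \<longleftrightarrow> x \<le> r y)"

lemma abstr_in_Pre: "up_closure a \<Longrightarrow> abstr a x \<in> Pre a"
  by (simp add: up_closure_def Pre_def abstr_def)

lemma Pre_Inf:
  assumes a: "up_closure a" and S: "S \<subseteq> Pre a"
  shows "Inf S \<in> Pre a"
proof -
  have "a (Inf S) \<le> x" if "x \<in> S" for x
  proof -
    have "a (Inf S) \<le> a x"
      using a that by (auto simp: up_closure_def intro: monoD Inf_lower)
    also have "\<dots> \<le> x" using S that by (auto simp: Pre_def)
    finally show ?thesis .
  qed
  then show ?thesis by (simp add: Pre_def Inf_greatest)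
qed

lemma lfp_on_Pre:
  assumes a: "up_closure a" and m: "mono_on (Pre a) F" and F: "F ` Pre a \<subseteq> Pre a"
  shows "lfp_on (Pre a) F \<in> Pre a" "F (lfp_on (Pre a) F) = lfp_on (Pre a) F"
    "\<And>y. y \<in> Pre a \<Longrightarrow> F y = y \<Longrightarrow> lfp_on (Pre a) F \<le> y"
proof -
  define S where "S = {x \<in> Pre a. F x \<le> x}"
  have P: "Inf S \<in> Pre a" by (rule Pre_Inf[OF a]) (auto simp: S_def)
  have le: "F (Inf S) \<le> Inf S"
  proof (rule Inf_greatest)
    fix x assume x: "x \<in> S"
    then have "F (Inf S) \<le> F x"
      using m P by (auto simp: S_def intro!: mono_onD[OF m] Inf_lower)
    with x show "F (Inf S) \<le> x" by (auto simp: S_def)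
  qed
  have "F (Inf S) \<in> S"
    using P F le m by (auto simp: S_def intro!: mono_onD[OF m])
  then have eq: "F (Inf S) = Inf S" using le by (simp add: Inf_lower antisym)
  have low: "\<And>y. y \<in> Pre a \<Longrightarrow> F y = y \<Longrightarrow> Inf S \<le> y"
    by (auto simp: S_def intro!: Inf_lower)
  have "lfp_on (Pre a) F = Inf S"
    unfolding lfp_on_def by (rule Least_equality) (use P eq low in auto)
  then show "lfp_on (Pre a) F \<in> Pre a" "F (lfp_on (Pre a) F) = lfp_on (Pre a) F"
    "\<And>y. y \<in> Pre a \<Longrightarrow> F y = y \<Longrightarrow> lfp_on (Pre a) F \<le> y"
    using P eq low by auto
qed

text \<open>The two forms of the compatibility condition are equivalent.\<close>

lemma compat_iff:
  assumes "mono l" "mono r" "left_adjoint l r" "mono a"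
  shows "l \<circ> a \<le> a \<circ> l \<longleftrightarrow> a \<circ> r \<le> r \<circ> a"
proof
  have adj: "\<And>x y. l x \<le> y \<longleftrightarrow> x \<le> r y" using assms(3) by (simp add: left_adjoint_def)
  { assume "l \<circ> a \<le> a \<circ> l"
    then have h: "\<And>x. l (a x) \<le> a (l x)" by (simp add: le_fun_def)
    have "a (r x) \<le> r (a x)" for x
      using h[of "r x"] adj[of "r x" x] monoD[OF assms(4), of "l (r x)" x]
      by (simp add: adj[symmetric])
    then show "a \<circ> r \<le> r \<circ> a" by (simp add: le_fun_def) }
  { assume "a \<circ> r \<le> r \<circ> a"
    then have h: "\<And>x. a (r x) \<le> r (a x)" by (simp add: le_fun_def)
    have "l (a x) \<le> a (l x)" for x
      using h[of "l x"] adj[of x "l x"] monoD[OF assms(4), of x "r (l x)"]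
      by (simp add: adj)
    then show "l \<circ> a \<le> a \<circ> l" by (simp add: le_fun_def) }
qed

end

theory Submission imports Defs begin

text \<open>Both claims only need commutation with the closure: the hypothesis on \<open>b_up\<close> gives
  \<open>g \<circ> a \<le> a \<circ> g\<close> for \<open>g = i \<squnion> b_up\<close>, and its adjoint form together with \<open>a f \<le> f\<close> gives
  \<open>a \<circ> h \<le> h \<circ> a\<close> for \<open>h = b_low \<sqinter> f\<close>. In the first case \<open>a (\<mu>g)\<close> is itself a fixed point of
  \<open>a \<circ> g\<close>, and it is the least one in \<open>Pre a\<close> because any other is a pre-fixed point of \<open>g\<close>;
  in the second case \<open>x \<le> h (a x)\<close> makes \<open>a x\<close> a post-fixed point of \<open>h\<close>.\<close>

lemma up_closureD:
  assumes "up_closure a"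
  shows "mono a" "x \<le> a x" "a (a x) \<le> a x"
  using assms by (auto simp: up_closure_def)

lemma complete_wrt_if_commute:
  assumes a: "up_closure a" and g: "mono g" and ga: "g \<circ> a \<le> a \<circ> g"
  shows "complete_wrt a g"
proof -
  note mono_a = monoD[OF up_closureD(1)[OF a]]
  have fixed: "g (lfp g) = lfp g" by (rule lfp_unfold[OF g, symmetric])
  \<comment> \<open>Commutation moves the inner \<open>a\<close> outward; idempotence then absorbs
    the doubled closure.\<close>
  have "a (g (a (lfp g))) \<le> a (a (g (lfp g)))"
    using ga by (intro mono_a) (simp add: le_fun_def)
  also have "\<dots> \<le> a (lfp g)" using up_closureD(3)[OF a] by (simp add: fixed)
  finally have le: "a (g (a (lfp g))) \<le> a (lfp g)" .
  have "a (g (lfp g)) \<le> a (g (a (lfp g)))"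
    by (intro mono_a monoD[OF g] up_closureD(2)[OF a])
  with le have eq: "a (g (a (lfp g))) = a (lfp g)" by (simp add: fixed)
  have least: "a (lfp g) \<le> y" if y: "a y \<le> y" "a (g y) = y" for y
  proof -
    \<comment> \<open>By extensivity \<open>g y\<close> lies below \<open>a (g y)\<close>, which is
      \<open>y\<close>; so \<open>lfp g\<close> is below \<open>y\<close>, and \<open>y\<close>
      being closed keeps this bound under \<open>a\<close>.\<close>
    have "g y \<le> y" using up_closureD(2)[OF a, of "g y"] y by simp
    then have "a (lfp g) \<le> a y" by (intro mono_a lfp_lowerbound)
    with y show ?thesis by simp
  qed
  have "lfp_on (Pre a) (abstr a \<circ> g \<circ> concr) = a (lfp g)"
    unfolding lfp_on_def
    by (rule Least_equality)
      (use eq least up_closureD(3)[OF a] in \<open>auto simp: Pre_def abstr_def concr_def\<close>)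
  then show ?thesis by (simp add: complete_wrt_def abstr_def)
qed

lemma sound_wrt_if_commute:
  assumes a: "up_closure a" and h: "mono h" and ah: "a \<circ> h \<le> h \<circ> a"
  shows "sound_wrt a h"
  unfolding sound_wrt_def
proof (intro allI impI, elim conjE)
  fix j x assume j: "j \<le> x" and x: "x \<le> h (a x)"
  have "a x \<le> a (h (a x))" by (rule monoD[OF up_closureD(1)[OF a] x])
  also have "\<dots> \<le> h (a (a x))" using ah by (simp add: le_fun_def)
  also have "\<dots> \<le> h (a x)" by (intro monoD[OF h] up_closureD(3)[OF a])
  finally have "a x \<le> gfp h" by (rule gfp_upperbound)
  with j up_closureD(2)[OF a, of x] show "j \<le> gfp h" by (blast intro: order_trans)
qed

theorem theorem6p3:
  fixes b_up b_low a :: "'a::complete_lattice \<Rightarrow> 'a" and i f :: 'a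
  assumes "mono b_up" and "mono b_low" and "left_adjoint b_up b_low"
    and "up_closure a" and "a f \<le> f"
    and "b_up \<circ> a \<le> a \<circ> b_up"
  shows "complete_wrt a (sup (\<lambda>_. i) b_up) \<and> sound_wrt a (inf b_low (\<lambda>_. f))"
proof
  have mono_a: "mono a" by (rule up_closureD(1)[OF assms(4)])
  show "complete_wrt a (sup (\<lambda>_. i) b_up)"
  proof (rule complete_wrt_if_commute[OF assms(4)])
    show "mono (sup (\<lambda>_. i) b_up)"
      using assms(1) by (auto simp: mono_def intro: le_supI2)
    \<comment> \<open>Extensivity takes care of the constant \<open>i\<close>; only
      \<open>b_up\<close> needs the commutation.\<close>
    have "sup i (b_up (a x)) \<le> a (sup i (b_up x))" for x
    proof (rule sup_least)
      show "i \<le> a (sup i (b_up x))"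
        by (rule order_trans[OF sup_ge1 up_closureD(2)[OF assms(4)]])
      have "b_up (a x) \<le> a (b_up x)" using assms(6) by (simp add: le_fun_def)
      also have "\<dots> \<le> a (sup i (b_up x))" by (rule monoD[OF mono_a sup_ge2])
      finally show "b_up (a x) \<le> a (sup i (b_up x))" .
    qed
    then show "sup (\<lambda>_. i) b_up \<circ> a \<le> a \<circ> sup (\<lambda>_. i) b_up" by (simp add: le_fun_def)
  qed
  show "sound_wrt a (inf b_low (\<lambda>_. f))"
  proof (rule sound_wrt_if_commute[OF assms(4)])
    show "mono (inf b_low (\<lambda>_. f))"
      using assms(2) by (auto simp: mono_def intro: le_infI1)
    have "a \<circ> b_low \<le> b_low \<circ> a"
      using compat_iff[OF assms(1-3) mono_a] assms(6) by simp
    then have low: "a (b_low x) \<le> b_low (a x)" for x by (simp add: le_fun_def)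
    \<comment> \<open>Monotonicity puts \<open>a\<close> of a meet below the closure of each
      component; \<open>f\<close> is itself closed, so its bound does not grow.\<close>
    have "a (inf (b_low x) f) \<le> inf (b_low (a x)) f" for x
      using order_trans[OF monoD[OF mono_a inf_le1] low]
        order_trans[OF monoD[OF mono_a inf_le2] assms(5)]
      by (rule inf_greatest)
    then show "a \<circ> inf b_low (\<lambda>_. f) \<le> inf b_low (\<lambda>_. f) \<circ> a" by (simp add: le_fun_def)
  qed
qed

end
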